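(* Let $r$ be an odd positive integer and let $\alpha,\lambda\in\mathbb C$. Then $$\sum_{k=0}^r2^{r-k}\binom{(r-1-\alpha)/2}{r-k}\binom{\alpha}{k}M_k(\lambda)=0.$$ In particular, for all integers $m,n\ge0$, $$\sum_{k=[n-m]_+}^{2n+1}(-1)^k2^{2n+1-k}\binom{m+n+1}{m-n+k}\binom{2m+k+1}{k}M_k(\lambda)=0.$$
   Context: $\binom{\beta}{k}=\beta(\beta-1)\cdots(\beta-k+1)/k!$ for $\beta\in\mathbb C$, and $[x]_+:=\max(x,0)$. For $0\le j\le\lfloor n/2\rfloor$ let $m_{n,j}:=\frac{n!}{(n-2j)!\,j!\,2^j}$ (the number of $j$-edge matchings of the complete graph $K_n$), and $M_n(\lambda):=\sum_{j=0}^{\lfloor n/2\rfloor}m_{n,j}\lambda^j$. *)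

theory Defs
  imports Complex_Main
begin

text \<open>
  The number of \<open>j\<close>-edge matchings of the complete graph on \<open>n\<close> vertices, as a complex number.
  It is only used for \<open>j \<le> n div 2\<close>, where the subtraction on \<^typ>\<open>nat\<close> is exact.
\<close>
definition matching_number :: "nat \<Rightarrow> nat \<Rightarrow> complex" where
  "matching_number n j = fact n / (fact (n - 2 * j) * fact j * 2 ^ j)"

definition matching_poly :: "nat \<Rightarrow> complex \<Rightarrow> complex" where
  "matching_poly n l = (\<Sum>j = 0..n div 2. matching_number n j * l ^ j)"

text \<open>
  Binomial coefficients with complex upper argument are \<^const>\<open>gbinomial\<close>. For natural numbers
  \<open>n, m\<close> the truncating difference \<open>n - m\<close> is the positive part \<open>max (n - m) 0\<close>. For \<open>k \<ge> n - m\<close>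
  the integer \<open>m - n + k\<close> is nonnegative, and the natural number \<open>m + k - n\<close> is that integer.
\<close>

end

theory Submission
  imports Defs "HOL-Computational_Algebra.Formal_Power_Series"
    "HOL-Computational_Algebra.Polynomial"
begin

text \<open>
  Extracting the coefficient of \<open>\<lambda>\<^sup>j\<close> replaces \<open>(r, \<alpha>)\<close> by \<open>(r - 2j, \<alpha> - 2j)\<close>, so it suffices
  that for odd \<open>s\<close> the coefficient of \<open>x\<^sup>s\<close> in \<open>(1 + 2x)\<^bsup>(s-1-a)/2\<^esup> (1 + x)\<^sup>a\<close> vanishes. That
  coefficient is a polynomial in \<open>a\<close>, so one may take \<open>a = 2N\<close>. Since \<open>(1 + x)\<^sup>2 = (1 + 2x) + x\<^sup>2\<close>,
  the series is then a combination of \<open>x\<^bsup>2p\<^esup> (1 + 2x)\<^bsup>(s-1)/2-p\<^esup>\<close>, and for \<open>2p < s\<close> this is a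
  polynomial of degree \<open>(s-1)/2 + p < s\<close>. The second identity is the case
  \<open>\<alpha> = -2m - 2\<close>, \<open>r = 2n + 1\<close> of the first.
\<close>

text \<open>The binomial series of (1 + 2x)^c. It is given by its coefficients because c is an
  arbitrary field element; below, c can be a negative integer.\<close>

definition fps_binomial_double :: "'a::field_char_0 \<Rightarrow> 'a fps" where
  "fps_binomial_double c = Abs_fps (\<lambda>n. 2 ^ n * (c gchoose n))"

lemma fps_binomial_double_nth [simp]: "fps_nth (fps_binomial_double c) n = 2 ^ n * (c gchoose n)"
  by (simp add: fps_binomial_double_def)

lemma fps_binomial_double_add:
  "fps_binomial_double (c + d) = fps_binomial_double c * fps_binomial_double d"
proof (rule fps_ext)
  fix n
  have "fps_nth (fps_binomial_double c * fps_binomial_double d) n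
      = (\<Sum>i=0..n. 2 ^ n * ((c gchoose i) * (d gchoose (n - i))))"
    unfolding fps_mult_nth
    by (intro sum.cong) (auto simp: mult_ac power_add simp flip: power_add)
  also have "\<dots> = 2 ^ n * ((c + d) gchoose n)"
    by (simp add: gbinomial_Vandermonde flip: sum_distrib_left)
  finally show "fps_nth (fps_binomial_double (c + d)) n
      = fps_nth (fps_binomial_double c * fps_binomial_double d) n" by simp
qed

lemma fps_binomial_double_1: "fps_binomial_double 1 = 1 + 2 * fps_X"
proof (rule fps_ext)
  fix n
  have "(1::'a) gchoose n = of_nat (1 choose n)"
    using binomial_gbinomial[of 1 n, where ?'a = 'a] by simp
  then show "fps_nth (fps_binomial_double (1::'a)) n = fps_nth (1 + 2 * fps_X) n"
    by (cases "n = 0"; cases "n = 1") (auto simp: fps_X_def numeral_fps_const)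
qed

lemma fps_binomial_double_of_nat:
  "fps_binomial_double (of_nat n) = (1 + 2 * fps_X) ^ n"
proof (induction n)
  case 0
  show ?case by (rule fps_ext) (auto simp: gbinomial_0_left)
next
  case (Suc n)
  then show ?case
    by (simp add: fps_binomial_double_add fps_binomial_double_1)
qed

text \<open>With s = 2h + 1 and a = 2N the exponent (s-1-a)/2 is h - N, so this is the coefficient
  of x^s in (1 + x)^(2N) (1 + 2x)^(h-N). N may exceed h.\<close>

lemma odd_convolution_even_nat:
  fixes h N :: nat
  shows "(\<Sum>i=0..2*h+1. (of_nat (2*N) gchoose i) *
           (2 ^ (2*h+1-i) * ((of_nat h - of_nat N :: 'a::field_char_0) gchoose (2*h+1-i)))) = 0"
proof -
  let ?B = "fps_binomial_double :: 'a \<Rightarrow> 'a fps" and ?X = "fps_X :: 'a fps"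
  have sq: "(1 + ?X) ^ 2 = ?X\<^sup>2 + (1 + 2 * ?X)"
    by (simp add: power2_eq_square algebra_simps)
  have "(1 + ?X) ^ (2*N)
      = (\<Sum>p\<le>N. of_nat (N choose p) * ?X\<^sup>2 ^ p * (1 + 2 * ?X) ^ (N - p))"
    unfolding power_mult sq by (rule binomial_ring)
  then have "(1 + ?X) ^ (2*N) * ?B (of_nat h - of_nat N)
      = (\<Sum>p\<le>N. of_nat (N choose p) * ?X\<^sup>2 ^ p * (1 + 2 * ?X) ^ (N - p)) * ?B (of_nat h - of_nat N)"
    by (rule arg_cong)
  also have "\<dots> = (\<Sum>p\<le>N. of_nat (N choose p) * (?X ^ (2*p) * ?B (of_nat h - of_nat p)))"
    unfolding sum_distrib_right
  proof (rule sum.cong)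
    fix p assume "p \<in> {..N}"
    then have "(of_nat h - of_nat p :: 'a) = of_nat (N - p) + (of_nat h - of_nat N)"
      by (simp add: of_nat_diff)
    then have "?B (of_nat h - of_nat p) = (1 + 2 * ?X) ^ (N - p) * ?B (of_nat h - of_nat N)"
      by (simp only: fps_binomial_double_add fps_binomial_double_of_nat)
    then show "of_nat (N choose p) * ?X\<^sup>2 ^ p * (1 + 2 * ?X) ^ (N - p) * ?B (of_nat h - of_nat N)
        = of_nat (N choose p) * (?X ^ (2*p) * ?B (of_nat h - of_nat p))"
      by (simp add: power_mult mult.assoc)
  qed simp
  finally have eq: "(1 + ?X) ^ (2*N) * ?B (of_nat h - of_nat N)
      = (\<Sum>p\<le>N. of_nat (N choose p) * (?X ^ (2*p) * ?B (of_nat h - of_nat p)))" .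
  \<comment> \<open>If 2p > 2h + 1, the factor x^(2p) removes the coefficient. Otherwise p \<le> h,
    so (1 + 2x)^(h-p) is a polynomial of degree h - p, which is less than 2(h-p) + 1, the index that
    remains after the shift.\<close>
  have "fps_nth (?X ^ (2*p) * ?B (of_nat h - of_nat p)) (2*h+1) = 0" for p
  proof (cases "2*h+1 < 2*p")
    case False
    then have p: "p \<le> h" by simp
    then have "(of_nat h - of_nat p :: 'a) gchoose (2*h+1-2*p) = of_nat ((h-p) choose (2*h+1-2*p))"
      by (simp add: binomial_gbinomial of_nat_diff)
    also have "\<dots> = 0" using p by (simp add: binomial_eq_0)
    finally show ?thesis by (simp add: fps_X_power_mult_nth)
  qed (simp add: fps_X_power_mult_nth)
  then have "fps_nth ((1 + ?X) ^ (2*N) * ?B (of_nat h - of_nat N)) (2*h+1) = 0"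
    unfolding eq fps_sum_nth by (intro sum.neutral) (simp add: fps_of_nat)
  moreover have "(1 + ?X) ^ (2*N) = fps_binomial (of_nat (2*N))"
    by (simp only: fps_binomial_of_nat)
  ultimately show ?thesis
    by (simp add: fps_mult_nth)
qed

text \<open>This turns an identity between generalized binomials into one between polynomials, which
  can be checked at infinitely many points.\<close>

lemma gbinomial_linear_eq_poly:
  "\<exists>p. \<forall>x::'a::field_char_0. (b * x + c) gchoose k = poly p x"
proof (intro exI allI)
  fix x :: 'a
  show "(b * x + c) gchoose k
      = poly (smult (1 / fact k) (\<Prod>i<k. [:c - of_nat i, b:])) x"
    by (simp add: gbinomial_prod_rev poly_prod lessThan_atLeast0 algebra_simps)
qed

lemma odd_convolution:
  fixes a :: "'a::field_char_0"
  assumes "odd s"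
  shows "(\<Sum>i=0..s. 2 ^ (s-i) * (((of_nat s - 1 - a) / 2) gchoose (s-i)) * (a gchoose i)) = 0"
proof -
  obtain h where s: "s = 2*h+1" using assms by (auto elim: oddE)
  have "\<exists>p. \<forall>x::'a. x gchoose i = poly p x" for i
    using gbinomial_linear_eq_poly[of 1 0 i] by simp
  then obtain P :: "nat \<Rightarrow> 'a poly" where P: "\<And>i x. x gchoose i = poly (P i) x"
    by metis
  have half: "(of_nat s - 1 - x) / 2 = - (1/2) * x + of_nat h" for x :: 'a
    by (simp add: s field_simps)
  have "\<exists>p. \<forall>x::'a. ((of_nat s - 1 - x) / 2) gchoose i = poly p x" for i
    unfolding half by (rule gbinomial_linear_eq_poly)
  then obtain Q :: "nat \<Rightarrow> 'a poly"
    where Q: "\<And>i x. ((of_nat s - 1 - x) / 2) gchoose i = poly (Q i) x"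
    by metis
  define R where "R = (\<Sum>i=0..s. smult (2 ^ (s-i)) (Q (s-i) * P i))"
  have R: "poly R x
      = (\<Sum>i=0..s. 2 ^ (s-i) * (((of_nat s - 1 - x) / 2) gchoose (s-i)) * (x gchoose i))" for x
    by (simp add: R_def poly_sum mult_ac flip: P Q)
  have "poly R (of_nat (2*N)) = 0" for N
  proof -
    have half_even: "(of_nat s - 1 - of_nat (2*N) :: 'a) / 2 = of_nat h - of_nat N"
      by (simp add: s field_simps)
    show ?thesis
      unfolding R half_even
      using odd_convolution_even_nat[of N h, where ?'a = 'a, folded s]
      by (simp only: mult_ac)
  qed
  \<comment> \<open>In characteristic 0 the even naturals are infinitely many roots, which forces
    \<open>R = 0\<close>.\<close>
  then have "range (\<lambda>N. of_nat (2*N)) \<subseteq> {x. poly R x = 0}" by blast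
  moreover have "infinite (range (\<lambda>N. of_nat (2*N) :: 'a))"
    by (rule range_inj_infinite) (simp add: inj_on_def)
  ultimately have "R = 0"
    using poly_roots_finite finite_subset by blast
  then show ?thesis using R[of a] by simp
qed

text \<open>A matching with j edges is a choice of the 2j covered vertices together with a perfect
  matching on them.\<close>

lemma matching_number_eq_choose:
  assumes "2 * j \<le> k"
  shows "matching_number k j = of_nat (k choose (2*j)) * matching_number (2*j) j"
  using assms by (simp add: matching_number_def binomial_fact)

text \<open>The range of j no longer depends on k, so the sums over k and j can be
  exchanged.\<close>

lemma matching_poly_eq_sum:
  assumes "k \<le> r"
  shows "matching_poly k l
    = (\<Sum>j=0..r div 2. if 2 * j \<le> k then matching_number k j * l ^ j else 0)"
proof -
  have "{0..k div 2} = {j \<in> {0..r div 2}. 2 * j \<le> k}" using assms by auto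
  then show ?thesis
    unfolding matching_poly_def by (simp only: sum.inter_filter finite_atLeastAtMost)
qed

lemma odd_matching_sum:
  fixes \<alpha> l :: complex
  assumes "odd r"
  shows "(\<Sum>k = 0..r. 2 ^ (r - k) * (((of_nat r - 1 - \<alpha>) / 2) gchoose (r - k))
           * (\<alpha> gchoose k) * matching_poly k l) = 0"
proof -
  let ?c = "\<lambda>k. 2 ^ (r - k) * (((of_nat r - 1 - \<alpha>) / 2) gchoose (r - k)) * (\<alpha> gchoose k)"
  \<comment> \<open>This is the coefficient of l^j in the whole sum.\<close>
  have coeff: "(\<Sum>k=0..r. if 2 * j \<le> k then ?c k * matching_number k j else 0) = 0"
    if "j \<le> r div 2" for j
  proof -
    have j: "2 * j \<le> r" using that by simp
    \<comment> \<open>Lowering r and \<alpha> together by 2j leaves this upper argument unchanged,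
      and r - 2j is still odd, so \<open>odd_convolution\<close> applies to the shifted
      pair.\<close>
    have beta: "(of_nat (r - 2*j) - 1 - (\<alpha> - of_nat (2*j))) / 2 = (of_nat r - 1 - \<alpha>) / 2"
      using j by (simp add: of_nat_diff)
    have "(\<Sum>k=0..r. if 2 * j \<le> k then ?c k * matching_number k j else 0)
        = (\<Sum>k=2*j..r. ?c k * matching_number k j)"
      by (rule sum.mono_neutral_cong_right) auto
    also have "\<dots> = (\<Sum>i=0..r-2*j. ?c (i+2*j) * matching_number (i+2*j) j)"
      using sum.shift_bounds_cl_nat_ivl[of "\<lambda>k. ?c k * matching_number k j" 0 "2*j" "r-2*j"] j
      by simp
    also have "\<dots> = (\<Sum>i=0..r-2*j. (\<alpha> gchoose (2*j)) * matching_number (2*j) j *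
        (2 ^ (r-2*j-i) * (((of_nat (r-2*j) - 1 - (\<alpha> - of_nat (2*j))) / 2) gchoose (r-2*j-i))
           * ((\<alpha> - of_nat (2*j)) gchoose i)))"
    proof (rule sum.cong)
      fix i
      have regroup: "x * y * a * (c * m) = d * m * (x * y * e)" if "a * c = d * e"
        for x y a c m d e :: complex
        using that by algebra
      \<comment> \<open>Trinomial revision separates a factor that is independent of i and can be
        pulled out of the sum.\<close>
      have "(\<alpha> gchoose (i+2*j)) * of_nat ((i+2*j) choose (2*j))
          = (\<alpha> gchoose (2*j)) * ((\<alpha> - of_nat (2*j)) gchoose i)"
        using gbinomial_trinomial_revision[of "2*j" "i+2*j" \<alpha>]
        by (simp only: binomial_gbinomial) simp
      moreover have sub: "r - (i + 2*j) = r - 2*j - i" by simp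
      ultimately show "?c (i+2*j) * matching_number (i+2*j) j
          = (\<alpha> gchoose (2*j)) * matching_number (2*j) j *
        (2 ^ (r-2*j-i) * (((of_nat (r-2*j) - 1 - (\<alpha> - of_nat (2*j))) / 2) gchoose (r-2*j-i))
           * ((\<alpha> - of_nat (2*j)) gchoose i))"
        unfolding beta sub matching_number_eq_choose[of j "i+2*j", simplified]
        by (intro regroup)
    qed simp
    also have "\<dots> = 0"
      using odd_convolution[of "r-2*j" "\<alpha> - of_nat (2*j)"] assms j
      by (simp only: sum_distrib_left[symmetric]) simp
    finally show ?thesis .
  qed
  have "(\<Sum>k=0..r. ?c k * matching_poly k l)
      = (\<Sum>k=0..r. \<Sum>j=0..r div 2. if 2*j \<le> k then ?c k * matching_number k j * l ^ j else 0)"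
    by (intro sum.cong) (auto simp: matching_poly_eq_sum[of _ r] sum_distrib_left mult.assoc
        intro!: sum.cong)
  also have "\<dots> = (\<Sum>j=0..r div 2.
      (\<Sum>k=0..r. if 2*j \<le> k then ?c k * matching_number k j else 0) * l ^ j)"
    by (subst sum.swap) (auto simp: sum_distrib_right intro!: sum.cong)
  also have "\<dots> = 0"
    using coeff by (intro sum.neutral) simp
  finally show ?thesis .
qed

theorem corollary6p2:
  fixes l :: complex
  shows "(\<forall>(r::nat) (\<alpha>::complex). odd r \<longrightarrow>
            (\<Sum>k = 0..r. 2 ^ (r - k) * (((of_nat r - 1 - \<alpha>) / 2) gchoose (r - k))
               * (\<alpha> gchoose k) * matching_poly k l) = 0)
       \<and> (\<forall>m n :: nat.
            (\<Sum>k = n - m..2 * n + 1. (-1) ^ k * 2 ^ (2 * n + 1 - k)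
               * ((of_nat (m + n + 1) :: complex) gchoose (m + k - n))
               * ((of_nat (2 * m + k + 1) :: complex) gchoose k) * matching_poly k l) = 0)"
proof (intro conjI allI impI)
  fix m n :: nat
  let ?r = "2 * n + 1" and ?\<alpha> = "- of_nat (2*m+2) :: complex"
  have beta: "(of_nat ?r - 1 - ?\<alpha>) / 2 = of_nat (m + n + 1)"
    by (simp add: field_simps)
  \<comment> \<open>Upper negation: k - 1 - \<alpha> = 2m + k + 1. This is the source of the
    sign.\<close>
  have upper: "(?\<alpha> gchoose k) = (-1) ^ k * (of_nat (2 * m + k + 1) gchoose k)" for k
    by (subst gbinomial_minus) (simp add: algebra_simps)
  \<comment> \<open>Symmetry of the binomial coefficient; the bound n - m \<le> k makes the
    truncated difference m + k - n exact.\<close>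
  have lower: "(of_nat (m + n + 1) :: complex) gchoose (?r - k)
      = of_nat (m + n + 1) gchoose (m + k - n)" if "n - m \<le> k" "k \<le> ?r" for k
  proof -
    have "m + n + 1 - (?r - k) = m + k - n" "?r - k \<le> m + n + 1" using that by auto
    then show ?thesis
      using binomial_symmetric[of "?r - k" "m + n + 1"] by (metis binomial_gbinomial)
  qed
  \<comment> \<open>Here 2n + 1 - k > m + n + 1, so the terms below n - m vanish and the sum may
    start at 0.\<close>
  have zero: "(of_nat (m + n + 1) :: complex) gchoose (?r - k) = 0" if "k < n - m" for k
  proof -
    have "(m + n + 1) choose (?r - k) = 0" using that by (intro binomial_eq_0) simp
    then show ?thesis by (metis binomial_gbinomial of_nat_0)
  qed
  have "(\<Sum>k = n - m..?r. (-1) ^ k * 2 ^ (?r - k)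
               * ((of_nat (m + n + 1) :: complex) gchoose (m + k - n))
               * ((of_nat (2 * m + k + 1) :: complex) gchoose k) * matching_poly k l)
      = (\<Sum>k = 0..?r. 2 ^ (?r - k) * (((of_nat ?r - 1 - ?\<alpha>) / 2) gchoose (?r - k))
               * (?\<alpha> gchoose k) * matching_poly k l)"
    unfolding beta
  proof (rule sum.mono_neutral_cong_left)
    show "\<forall>k\<in>{0..?r} - {n - m..?r}. 2 ^ (?r - k) * (of_nat (m + n + 1) gchoose (?r - k))
               * (?\<alpha> gchoose k) * matching_poly k l = 0"
      using zero by (auto simp del: of_nat_add of_nat_Suc)
    fix k assume "k \<in> {n - m..?r}"
    then show "(-1) ^ k * 2 ^ (?r - k)
               * ((of_nat (m + n + 1) :: complex) gchoose (m + k - n))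
               * ((of_nat (2 * m + k + 1) :: complex) gchoose k) * matching_poly k l
      = 2 ^ (?r - k) * (of_nat (m + n + 1) gchoose (?r - k))
               * (?\<alpha> gchoose k) * matching_poly k l"
      unfolding upper using lower[of k] by (simp only: atLeastAtMost_iff mult_ac)
  qed auto
  also have "\<dots> = 0" by (rule odd_matching_sum) simp
  finally show "(\<Sum>k = n - m..?r. (-1) ^ k * 2 ^ (?r - k)
               * ((of_nat (m + n + 1) :: complex) gchoose (m + k - n))
               * ((of_nat (2 * m + k + 1) :: complex) gchoose k) * matching_poly k l) = 0" .
qed (rule odd_matching_sum)

end
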